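(* Let $X=\{a,b\}$, let $u=u_1\dots u_d$ be a nonempty finite non-periodic word over $X$ and $W=u^\infty$. Let $v_0,v_1,\dots,v_n$ be all forks of $W$, ordered so that $z_0\le z_1\le\dots\le z_n$ where $z_i=z(v_i)$, with $v_0=W$ and $v_n=\Lambda$. For every exceptional index $i$, let $j(i)$ denote the index with $v_{j(i)}=\Psi(v_i)$. Then for each exceptional index $i$ there exists an index $k(i)$ with $i<k(i)<j(i)$ such that $z_{j(i)}\le z_{j(i)-1}+z_{i-1}$ and $z_{k(i)}\le z_{k(i)-1}+z_{i-2}$. Moreover, $j(i)\ne j(i')$ for distinct exceptional indices $i\ne i'$; no $k(i)$ equals any $j(i')$ ($i,i'$ exceptional); and all indices $j(i)$ and $k(i)$ are regular.
   Context: A nonempty finite word is periodic if it equals $v^m$ for some word $v$ and $m\ge2$. $W=u^\infty$ is the two-sided infinite word with period $u$; $\Lambda$ is the empty word. $v\preceq w$ means $v$ is a subword of $w$ (for finite $v$ and $w=W$: $v$ occurs in $W$); $\prec$ means proper subword. A fork is a finite word $v$ such that $va,vb,av,bv$ are all subwords of $W$; by convention $W$ itself is also a fork. Significance: for a finite word $v$ of length $t$, $z(v)=|\{1\le i\le d: u_i\dots u_{i+t-1}=v\}|$, where indices are taken cyclically ($u_{i+d}=u_i$); $z(W)=1$. An index $i\ge2$ (and the fork $v_i$) is exceptional if $z_i>z_{i-1}+z_{i-2}$; otherwise (and always for $i=0,1$) it is regular. For an exceptional fork $v_i$, $\Psi(v_i)$ is the longest proper prefix of $v_{i-1}$ that is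 a fork. *)

theory Defs
  imports Main "HOL-Library.Sublist"
begin

datatype letter = La | Lb

definition periodic_word :: "letter list \<Rightarrow> bool" where
  "periodic_word w \<longleftrightarrow> w \<noteq> [] \<and> (\<exists>v m. 2 \<le> m \<and> w = concat (replicate m v))"

text \<open>A two-sided infinite word is a function on the integers. The periodic word
  \<open>inf_power u\<close> is positioned so that position \<open>1\<close> carries the first letter of \<open>u\<close>;
  thus its letter at position \<open>i\<close> is \<open>u\<^sub>i\<close>, with indices read cyclically.\<close>

definition inf_power :: "letter list \<Rightarrow> int \<Rightarrow> letter" where
  "inf_power u i = u ! nat ((i - 1) mod int (length u))"

definition factor :: "(int \<Rightarrow> letter) \<Rightarrow> int \<Rightarrow> nat \<Rightarrow> letter list" where
  "factor W i t = map (\<lambda>k. W (i + int k)) [0..<t]"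

definition occurs_in :: "letter list \<Rightarrow> (int \<Rightarrow> letter) \<Rightarrow> bool" where
  "occurs_in v W \<longleftrightarrow> (\<exists>i. factor W i (length v) = v)"

text \<open>Forks are finite words, except for \<open>W\<close> itself; hence a common type of
  finite and two-sided infinite words.\<close>

datatype gen_word = Fin "letter list" | BiInf "int \<Rightarrow> letter"

fun is_fork :: "letter list \<Rightarrow> gen_word \<Rightarrow> bool" where
  "is_fork u (Fin v) \<longleftrightarrow>
     occurs_in (v @ [La]) (inf_power u) \<and> occurs_in (v @ [Lb]) (inf_power u) \<and>
     occurs_in (La # v) (inf_power u) \<and> occurs_in (Lb # v) (inf_power u)"
| "is_fork u (BiInf w) \<longleftrightarrow> w = inf_power u"

text \<open>The value at \<open>BiInf w\<close> is only relevant for \<open>w = inf_power u\<close>.\<close>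

fun significance :: "letter list \<Rightarrow> gen_word \<Rightarrow> nat" where
  "significance u (Fin v) =
     card {i \<in> {1..int (length u)}. factor (inf_power u) i (length v) = v}"
| "significance u (BiInf w) = 1"

text \<open>\<open>v 0, \<dots>, v n\<close> lists all forks, each exactly once, by nondecreasing
  significance, from the infinite word to the empty word. The order among forks of
  equal significance is arbitrary.\<close>

definition fork_enumeration :: "letter list \<Rightarrow> nat \<Rightarrow> (nat \<Rightarrow> gen_word) \<Rightarrow> bool" where
  "fork_enumeration u n v \<longleftrightarrow>
     bij_betw v {0..n} {x. is_fork u x} \<and>
     (\<forall>i j. i \<le> j \<and> j \<le> n \<longrightarrow> significance u (v i) \<le> significance u (v j)) \<and>
     v 0 = BiInf (inf_power u) \<and> v n = Fin []"

definition exceptional :: "letter list \<Rightarrow> nat \<Rightarrow> (nat \<Rightarrow> gen_word) \<Rightarrow> nat \<Rightarrow> bool" where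
  "exceptional u n v i \<longleftrightarrow> 2 \<le> i \<and> i \<le> n \<and>
     significance u (v i) > significance u (v (i - 1)) + significance u (v (i - 2))"

definition regular :: "letter list \<Rightarrow> nat \<Rightarrow> (nat \<Rightarrow> gen_word) \<Rightarrow> nat \<Rightarrow> bool" where
  "regular u n v i \<longleftrightarrow> i \<le> n \<and> \<not> exceptional u n v i"

definition longest_fork_prefix :: "letter list \<Rightarrow> letter list \<Rightarrow> letter list" where
  "longest_fork_prefix u w = (ARG_MAX length p. strict_prefix p w \<and> is_fork u (Fin p))"

text \<open>\<open>Psi u v i\<close> is \<open>\<Psi>(v\<^sub>i)\<close>, meant for exceptional \<open>i\<close>. The index \<open>i - 1\<close> then lies
  strictly between \<open>0\<close> and \<open>n\<close>, so \<open>v (i - 1)\<close> is a nonempty finite word, which has the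
  empty word as a proper fork prefix; the case of an infinite word never arises.\<close>

definition Psi :: "letter list \<Rightarrow> (nat \<Rightarrow> gen_word) \<Rightarrow> nat \<Rightarrow> gen_word" where
  "Psi u v i = (case v (i - 1) of Fin w \<Rightarrow> Fin (longest_fork_prefix u w) | BiInf w \<Rightarrow> BiInf w)"

end

(*
  Let occ x be the number of occurrences of x in W per period. Every occurring word x extends,
  without changing occ, to a fork, so occ x is always one of the z_l. A finite fork x satisfies
  occ x = occ (xa) + occ (xb), both summands being some z_l of smaller index. Hence if v_i is
  exceptional, then occ (v_i a) = occ (v_i b) = m and z_i = 2m, where m = z_{i-1} > z_{i-2}, and
  no word has strictly between m and 2m occurrences.

  Let w = v_{i-1}, let p be its longest proper fork prefix and let pc be a prefix of w. By
  maximality of p, occ (pc) = occ w = m. The gap between m and 2m forces occ (pc') >= 2m for the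
  other letter c', so m is recovered from p and j is injective.

  For k(i) take a fork r, with occ r as small as possible, such that 2m <= occ r < occ p and
  occ (re) < m for some letter e. One exists: since p has more than 2m occurrences, some letter
  f gives occ (fp) > m, while occ (fpc) = occ (fw) < m; so fp is right special, and it extends to
  the left to a fork. If r were Psi of another exceptional fork, the same construction applied
  to r in place of p would contradict minimality.
*)

theory Submission
  imports Defs
begin

section \<open>Letters, factors of a two-sided word and counting modulo a period\<close>

fun other :: "letter \<Rightarrow> letter" where
  "other La = Lb"
| "other Lb = La"

lemma letter_cases: "c = d \<or> c = other d"
  by (cases c; cases d) auto

lemma other_neq [simp]: "other c \<noteq> c" "c \<noteq> other c"
  by (cases c; simp)+

lemma other_other [simp]: "other (other c) = c"
  by (cases c) auto

lemma factor_Suc: "factor W i (Suc t) = factor W i t @ [W (i + int t)]"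
  by (simp add: factor_def)

lemma factor_Suc_Cons: "factor W i (Suc t) = W i # factor W (i + 1) t"
  by (simp add: factor_def upt_conv_Cons map_Suc_upt[symmetric] algebra_simps del: upt_Suc)

lemma length_factor [simp]: "length (factor W i t) = t"
  by (simp add: factor_def)

lemma nth_factor: "k < t \<Longrightarrow> factor W i t ! k = W (i + int k)"
  by (simp add: factor_def)

lemma finite_int_interval_filter [simp]: "finite {i::int. a \<le> i \<and> i \<le> b \<and> P i}"
  by (rule finite_subset[of _ "{a..b}"]) auto

text \<open>Away from the ends the shift is a bijection; the only positions exchanged are
  \<open>1\<close> and \<open>1 + d\<close>, on which \<open>P\<close> agrees. It serves to count
  left extensions, since \<open>c # x\<close> at \<open>i\<close> means \<open>x\<close> at
  \<open>i + 1\<close>.\<close>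

lemma card_cyclic_shift:
  fixes P :: "int \<Rightarrow> bool"
  assumes "0 < d" and "P (1 + d) = P 1"
  shows "card {i \<in> {1..d}. P (i + 1)} = card {i \<in> {1..d}. P i}"
proof -
  define M where "M = {i \<in> {2..d}. P i}"
  have fin: "finite M" and 1: "1 \<notin> M" "1 + d \<notin> M"
    by (auto simp: M_def)
  have "card {i \<in> {1..d}. P (i + 1)} = card ((\<lambda>i. i + 1) ` {i \<in> {1..d}. P (i + 1)})"
    by (rule card_image[symmetric]) (auto simp: inj_on_def)
  also have "(\<lambda>i. i + 1) ` {i \<in> {1..d}. P (i + 1)} = {i \<in> {2..d + 1}. P i}"
  proof -
    have "x \<in> (\<lambda>i. i + 1) ` {i \<in> {1..d}. P (i + 1)}" if "2 \<le> x" "x \<le> d + 1" "P x" for x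
      using that by (intro image_eqI[of _ _ "x - 1"]) auto
    then show ?thesis by auto
  qed
  also have "\<dots> = (if P 1 then insert (1 + d) M else M)"
  proof -
    have "i = 1 + d \<or> i \<le> d" if "i \<le> d + 1" for i :: int
      using that by auto
    then show ?thesis
      using assms unfolding M_def by fastforce
  qed
  also have "card \<dots> = card (if P 1 then insert 1 M else M)"
    using fin 1 by simp
  also have "(if P 1 then insert 1 M else M) = {i \<in> {1..d}. P i}"
  proof -
    have "i = 1 \<or> 2 \<le> i" if "1 \<le> i" for i :: int
      using that by auto
    then show ?thesis
      using assms unfolding M_def by fastforce
  qed
  finally show ?thesis .
qed

section \<open>Occurrence counts, special words and extension to the left\<close>

definition occ :: "letter list \<Rightarrow> letter list \<Rightarrow> nat" where
  "occ u x = significance u (Fin x)"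

definition right_special :: "letter list \<Rightarrow> letter list \<Rightarrow> bool" where
  "right_special u x \<longleftrightarrow> (\<forall>c. 0 < occ u (x @ [c]))"

definition left_special :: "letter list \<Rightarrow> letter list \<Rightarrow> bool" where
  "left_special u x \<longleftrightarrow> (\<forall>c. 0 < occ u (c # x))"

declare is_fork.simps(1) [simp del]

locale nonempty_word =
  fixes u :: "letter list"
  assumes nonempty: "u \<noteq> []"
begin

abbreviation "W \<equiv> inf_power u"
abbreviation "d \<equiv> int (length u)"

lemma d_pos: "0 < d"
  using nonempty by simp

lemma W_mod: "W (1 + (i - 1) mod d + k) = W (i + k)"
proof -
  have "((i - 1) mod d + k) mod d = (i + k - 1) mod d"
    by (metis add_diff_eq diff_add_eq mod_add_left_eq)
  then show ?thesis
    by (simp add: inf_power_def)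
qed

lemma W_period: "W (i + d) = W i"
proof -
  have "(i + d - 1) mod d = (i - 1 + d) mod d"
    by (simp add: algebra_simps)
  then show ?thesis
    by (simp add: inf_power_def)
qed

lemma factor_period: "factor W (i + d) t = factor W i t"
  using W_period[of "i + int _"] by (auto simp: factor_def algebra_simps)

lemma factor_mod: "factor W (1 + (i - 1) mod d) t = factor W i t"
  by (simp add: factor_def W_mod)

lemma occ_pos_iff: "0 < occ u x \<longleftrightarrow> occurs_in x W"
proof
  assume "0 < occ u x"
  then have "{i \<in> {1..d}. factor W i (length x) = x} \<noteq> {}"
    by (metis occ_def significance.simps(1) card.empty less_irrefl)
  then show "occurs_in x W"
    by (auto simp: occurs_in_def)
next
  assume "occurs_in x W"
  then obtain i where "factor W i (length x) = x"
    by (auto simp: occurs_in_def)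
  then have "1 + (i - 1) mod d \<in> {i \<in> {1..d}. factor W i (length x) = x}"
    using pos_mod_bound[OF d_pos, of "i - 1"] pos_mod_sign[OF d_pos, of "i - 1"]
    by (simp add: factor_mod)
  then show "0 < occ u x"
    unfolding occ_def significance.simps by (subst card_gt_0_iff) auto
qed

lemma occ_snoc: "occ u x = occ u (x @ [c]) + occ u (x @ [other c])"
proof -
  let ?S = "\<lambda>c. {i \<in> {1..d}. factor W i (length (x @ [c])) = x @ [c]}"
  have "{i \<in> {1..d}. factor W i (length x) = x} = ?S c \<union> ?S (other c)"
    using letter_cases by (fastforce simp: factor_Suc)
  moreover have "?S c \<inter> ?S (other c) = {}"
    by (auto dest: sym)
  ultimately show ?thesis
    unfolding occ_def significance.simps by (simp add: card_Un_disjoint)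
qed

lemma occ_Cons: "occ u x = occ u (c # x) + occ u (other c # x)"
proof -
  let ?S = "\<lambda>c. {i \<in> {1..d}. factor W i (length (c # x)) = c # x}"
  have "{i \<in> {1..d}. factor W (i + 1) (length x) = x} = ?S c \<union> ?S (other c)"
    using letter_cases by (fastforce simp: factor_Suc_Cons)
  moreover have "?S c \<inter> ?S (other c) = {}"
    by (auto dest: sym)
  moreover have "card {i \<in> {1..d}. factor W (i + 1) (length x) = x}
      = card {i \<in> {1..d}. factor W i (length x) = x}"
    by (rule card_cyclic_shift) (simp_all add: d_pos nonempty factor_period)
  ultimately show ?thesis
    unfolding occ_def significance.simps by (simp add: card_Un_disjoint)
qed

lemma occ_append_le: "occ u (x @ t) \<le> occ u x"
proof (induction t rule: rev_induct)
  case (snoc c t)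
  then show ?case
    using occ_snoc[of "x @ t" c] by simp
qed simp

lemma occ_prepend_le: "occ u (s @ x) \<le> occ u x"
proof (induction s)
  case (Cons c s)
  then show ?case
    using occ_Cons[of "s @ x" c] by simp
qed simp

text \<open>If \<open>t\<close> follows every occurrence of \<open>x\<close>, it also follows those
  preceded by \<open>e\<close>. In terms of counts: the sums over the two left letters agree and the
  summands compare termwise.\<close>

lemma occ_Cons_append_eq:
  assumes "occ u (x @ t) = occ u x"
  shows "occ u (e # x @ t) = occ u (e # x)"
  using assms occ_Cons[of x e] occ_Cons[of "x @ t" e] occ_append_le[of "e # x" t]
    occ_append_le[of "other e # x" t]
  by simp

lemma occ_prepend_snoc_eq:
  assumes "occ u (s @ x) = occ u x"
  shows "occ u (s @ x @ [c]) = occ u (x @ [c])"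
  using assms occ_snoc[of x c] occ_snoc[of "s @ x" c] occ_prepend_le[of s "x @ [c]"]
    occ_prepend_le[of s "x @ [other c]"]
  by simp

lemma fork_iff: "is_fork u (Fin x) \<longleftrightarrow> left_special u x \<and> right_special u x"
  unfolding is_fork.simps left_special_def right_special_def occ_pos_iff by (metis letter.exhaust)

lemma left_special_prefix: "left_special u (x @ t) \<Longrightarrow> left_special u x"
  unfolding left_special_def by (metis append_Cons gr0I le_zero_eq occ_append_le)

lemma right_special_occ_less: "right_special u x \<Longrightarrow> occ u (x @ [c]) < occ u x"
  using occ_snoc[of x c] by (simp add: right_special_def)

lemma left_special_occ_less: "left_special u x \<Longrightarrow> occ u (c # x) < occ u x"
  using occ_Cons[of x c] by (simp add: left_special_def)

lemma not_right_specialE: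
  assumes "\<not> right_special u x"
  obtains c where "occ u (x @ [c]) = occ u x"
  using assms occ_snoc by (metis add.right_neutral add_0 gr0I right_special_def)

lemma not_left_specialE:
  assumes "\<not> left_special u x"
  obtains c where "occ u (c # x) = occ u x"
  using assms occ_Cons by (metis add.right_neutral add_0 gr0I left_special_def)

lemma occ_ge_2: "right_special u x \<Longrightarrow> 2 \<le> occ u x"
  using occ_snoc[of x La] by (simp add: right_special_def)
    (metis One_nat_def Suc_leI add_mono one_add_one plus_nat.add_0)

text \<open>If \<open>x\<close> is at least as long as the period, the letter after any occurrence
  of \<open>x\<close> repeats a letter inside \<open>x\<close>, one period earlier, so
  \<open>x\<close> determines it.\<close>

lemma right_special_length:
  assumes "right_special u x"
  shows "length x < length u"
proof (rule ccontr)
  assume "\<not> length x < length u"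
  then have le: "length u \<le> length x"
    by simp
  have "x ! (length x - length u) = c" for c
  proof -
    obtain i where "factor W i (Suc (length x)) = x @ [c]"
      using assms by (auto simp: right_special_def occ_pos_iff occurs_in_def)
    then have i: "factor W i (length x) = x" "W (i + int (length x)) = c"
      by (simp_all add: factor_Suc)
    have "x ! (length x - length u) = W (i + int (length x - length u))"
      using le nonempty i(1) nth_factor[of "length x - length u" "length x" W i]
      by (cases "length u") auto
    also have "\<dots> = W (i + int (length x))"
      using W_period[of "i + int (length x - length u)"] le by (simp add: of_nat_diff)
    finally show ?thesis
      using i(2) by simp
  qed
  from this[of La] this[of Lb] show False
    by simp
qed

text \<open>A word that is not left special has a left extension with the same count, and this
  extension inherits right specialness by \<open>occ_prepend_snoc_eq\<close>. The length bound for
  right special words makes the process stop.\<close>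

lemma left_closure:
  assumes "right_special u x"
  obtains s where "is_fork u (Fin (s @ x))" and "occ u (s @ x) = occ u x"
proof -
  have "\<exists>s. is_fork u (Fin (s @ x)) \<and> occ u (s @ x) = occ u x"
    using assms
  proof (induction "length u - length x" arbitrary: x rule: less_induct)
    case less
    show ?case
    proof (cases "left_special u x")
      case True
      with less.prems have "is_fork u (Fin ([] @ x)) \<and> occ u ([] @ x) = occ u x"
        by (simp add: fork_iff)
      then show ?thesis by blast
    next
      case False
      then obtain c where c: "occ u ([c] @ x) = occ u x"
        by (auto elim: not_left_specialE)
      have rs: "right_special u ([c] @ x)"
        using less.prems occ_prepend_snoc_eq[OF c] by (simp add: right_special_def)
      moreover have "length u - length ([c] @ x) < length u - length x"
        using right_special_length[OF rs] by simp
      ultimately obtain s where "is_fork u (Fin (s @ [c] @ x))" "occ u (s @ [c] @ x) = occ u ([c] @ x)"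
        using less.hyps by blast
      then show ?thesis
        using c by (metis append.assoc)
    qed
  qed
  then show ?thesis
    using that by blast
qed

end

section \<open>Primitivity and the extension of occurring words to forks\<close>

locale primitive_word = nonempty_word +
  assumes primitive: "\<not> periodic_word u"
begin

text \<open>Two equal windows of full period length at distance \<open>s\<close> give
  \<open>W\<close> the period \<open>s\<close> as well. Then rotating \<open>u\<close> by
  \<open>s\<close> fixes \<open>u\<close>, so its two pieces commute and are powers of a common
  word, which makes \<open>u\<close> periodic.\<close>

lemma factor_length_inj:
  assumes "factor W i (length u) = factor W k (length u)" and "1 \<le> i" "i < k" "k \<le> d"
  shows False
proof -
  define s where "s = nat (k - i)"
  have s: "0 < s" "s < length u" "k = i + int s"
    using assms by (auto simp: s_def)
  \<comment> \<open>Every \<open>m\<close> is congruent modulo \<open>d\<close> to the position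
    \<open>i + ?r\<close> inside the window starting at \<open>i\<close>, where the two windows can
    be compared.\<close>
  have shift: "W (m + int s) = W m" for m
  proof -
    let ?r = "(m - i) mod d"
    have r: "0 \<le> ?r" "?r < d"
      using d_pos by auto
    have mod: "W (i + ?r + l) = W (m + l)" for l
    proof -
      have "(i + ?r + l - 1) mod d = (m + l - 1) mod d"
        using mod_add_right_eq[of "i + l - 1" "m - i" d] by (simp add: algebra_simps)
      then show ?thesis
        by (simp add: inf_power_def)
    qed
    have "W (i + int (nat ?r)) = W (k + int (nat ?r))"
      using assms(1) r by (metis nat_less_iff nth_factor)
    then show ?thesis
      using mod[of 0] mod[of "int s"] r s(3) by (simp add: algebra_simps)
  qed
  have "drop s u @ take s u = u"
  proof (rule nth_equalityI)
    fix l assume "l < length (drop s u @ take s u)"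
    then have l: "l < length u"
      by simp
    have nth: "u ! m = W (1 + int m)" if "m < length u" for m
      using that by (simp add: inf_power_def)
    show "(drop s u @ take s u) ! l = u ! l"
    proof (cases "l < length u - s")
      case True
      then show ?thesis
        using nth[of l] nth[of "s + l"] shift[of "1 + int l"] by (simp add: nth_append algebra_simps)
    next
      case False
      let ?m = "l - (length u - s)"
      \<comment> \<open>Here the position shifted by \<open>s\<close> has run past the end of
        \<open>u\<close> and wraps around by one period.\<close>
      have "1 + int ?m + d = 1 + int l + int s"
        using False s by simp
      then have "W (1 + int ?m) = W (1 + int l)"
        using W_period[of "1 + int ?m"] shift[of "1 + int l"] by metis
      then show ?thesis
        using False l s nth[of l] nth[of ?m] by (simp add: nth_append)
    qed
  qed simp
  then have "take s u @ drop s u = drop s u @ take s u"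
    by simp
  then obtain m n zs where mn: "concat (replicate m zs) = take s u" "concat (replicate n zs) = drop s u"
    using comm_append_are_replicate by blast
  then have "m \<noteq> 0" "n \<noteq> 0"
    using s by (auto intro!: Nat.gr0I)
  moreover have "u = concat (replicate (m + n) zs)"
    by (simp add: replicate_add mn)
  ultimately have "periodic_word u"
    unfolding periodic_word_def using nonempty
    by (metis One_nat_def Suc_leI add_mono gr0I one_add_one)
  with primitive show False ..
qed

lemma long_occ_le_1:
  assumes "length u \<le> length x"
  shows "occ u x \<le> 1"
proof -
  have False if "i < k" "1 \<le> i" "k \<le> d" "factor W i (length x) = x" "factor W k (length x) = x" for i k
  proof -
    have "factor W l (length u) = take (length u) (factor W l (length x))" for l
      using assms by (intro nth_equalityI) (auto simp: nth_factor)
    then show False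
      using that factor_length_inj by metis
  qed
  then have "i = k" if "i \<in> {i \<in> {1..d}. factor W i (length x) = x}"
    "k \<in> {i \<in> {1..d}. factor W i (length x) = x}" for i k
    using that by (cases i k rule: linorder_cases) auto
  then show ?thesis
    unfolding occ_def significance.simps by (subst card_le_Suc0_iff_eq[folded One_nat_def]) auto
qed

text \<open>Extending by forced letters keeps the count; a count of at least 2 keeps the length
  below that of \<open>u\<close> by \<open>long_occ_le_1\<close>, so a right special word is
  reached.\<close>

lemma right_closure:
  assumes "2 \<le> occ u x"
  obtains t where "right_special u (x @ t)" and "occ u (x @ t) = occ u x"
proof -
  have "\<exists>t. right_special u (x @ t) \<and> occ u (x @ t) = occ u x"
    using assms
  proof (induction "length u - length x" arbitrary: x rule: less_induct)
    case less
    show ?case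
    proof (cases "right_special u x")
      case True
      then show ?thesis by (intro exI[of _ "[]"]) simp
    next
      case False
      then obtain c where c: "occ u (x @ [c]) = occ u x"
        by (auto elim: not_right_specialE)
      have "length x < length u"
        using long_occ_le_1[of x] less.prems by linarith
      then obtain t where "right_special u ((x @ [c]) @ t)" "occ u ((x @ [c]) @ t) = occ u (x @ [c])"
        using less.hyps[of "x @ [c]"] less.prems c by (metis diff_less_mono2 length_append_singleton lessI)
      then show ?thesis
        using c by auto
    qed
  qed
  then show ?thesis
    using that by blast
qed

text \<open>The extension goes right first, since \<open>left_closure\<close> preserves right
  specialness. Words with a single occurrence per period are accounted for by the fork
  \<open>W\<close>, of significance 1.\<close>

lemma fork_closure:
  assumes "0 < occ u x"
  obtains (word) s t where "is_fork u (Fin (s @ x @ t))" and "occ u (s @ x @ t) = occ u x"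
  | (infinite) "occ u x = 1"
proof (cases "2 \<le> occ u x")
  case True
  then obtain t where t: "right_special u (x @ t)" "occ u (x @ t) = occ u x"
    using right_closure by blast
  then obtain s where "is_fork u (Fin (s @ x @ t))" "occ u (s @ x @ t) = occ u (x @ t)"
    using left_closure by blast
  then show ?thesis
    using t word by simp
next
  case False
  then show ?thesis
    using assms infinite by linarith
qed

end

section \<open>The enumeration of forks by significance\<close>

locale fork_list = primitive_word +
  fixes n :: nat and v :: "nat \<Rightarrow> gen_word"
  assumes enumeration: "fork_enumeration u n v"
begin

definition z :: "nat \<Rightarrow> nat" where
  "z i = significance u (v i)"

lemma z_mono: "i \<le> k \<Longrightarrow> k \<le> n \<Longrightarrow> z i \<le> z k"
  using enumeration by (auto simp: fork_enumeration_def z_def)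

lemma z_less_imp_less: "z i < z k \<Longrightarrow> i \<le> n \<Longrightarrow> i < k"
  using z_mono by (meson leI leD)

lemma fork_v: "i \<le> n \<Longrightarrow> is_fork u (v i)"
  using enumeration bij_betwE by (fastforce simp: fork_enumeration_def)

lemma v_eq_iff: "i \<le> n \<Longrightarrow> k \<le> n \<Longrightarrow> v i = v k \<longleftrightarrow> i = k"
  using enumeration by (auto simp: fork_enumeration_def bij_betw_def inj_on_def)

lemma fork_index:
  assumes "is_fork u x"
  obtains i where "i \<le> n" and "v i = x"
proof -
  have "x \<in> v ` {0..n}"
    using assms enumeration by (auto simp: fork_enumeration_def bij_betw_def)
  then show ?thesis
    using that by auto
qed

lemma v_0: "v 0 = BiInf W" and v_n: "v n = Fin []"
  using enumeration by (auto simp: fork_enumeration_def)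

lemma finite_forkE:
  assumes "0 < i" "i \<le> n"
  obtains w where "v i = Fin w"
proof (cases "v i")
  case (BiInf w)
  then have "v i = v 0"
    using fork_v[OF assms(2)] v_0 by simp
  then show ?thesis
    using assms v_eq_iff by simp
qed (use that in auto)

lemma occ_in_range:
  assumes "0 < occ u x"
  obtains l where "l \<le> n" and "z l = occ u x"
  using assms
proof (cases rule: fork_closure)
  case (word s t)
  then show ?thesis
    using that fork_index by (metis z_def occ_def)
next
  case infinite
  then show ?thesis
    using that[of 0] by (simp add: z_def v_0)
qed

lemma occ_less_le_pred:
  assumes "0 < occ u x" and "occ u x < z i" and "i \<le> n"
  shows "occ u x \<le> z (i - 1)"
proof -
  obtain l where l: "l \<le> n" "z l = occ u x"
    using assms(1) occ_in_range by blast
  then have "l < i"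
    using assms z_less_imp_less by simp
  then show ?thesis
    using l assms z_mono[of l "i - 1"] by simp
qed

end

section \<open>An exceptional fork and the gap below its significance\<close>

locale exceptional_fork = fork_list +
  fixes i :: nat
  assumes exceptional: "exceptional u n v i"
begin

definition m :: nat where
  "m = z (i - 1)"

lemma i_bounds: "2 \<le> i" "i \<le> n"
  and z_i: "z i > z (i - 1) + z (i - 2)"
  using exceptional by (auto simp: exceptional_def z_def)

lemma fork_i:
  obtains x where "v i = Fin x" and "is_fork u (Fin x)" and "z i = occ u x"
  using finite_forkE[of i] i_bounds fork_v[of i] by (metis z_def occ_def less_le_trans zero_less_numeral)

text \<open>The counts of the two right extensions are some \<open>z k\<close> and
  \<open>z l\<close> with \<open>k, l < i\<close>. If one of these indices were at most
  \<open>i - 2\<close>, their sum could not exceed \<open>z (i - 1) + z (i - 2)\<close>; hence both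
  are \<open>i - 1\<close>.\<close>

lemma occ_snoc_eq_m:
  assumes "v i = Fin x"
  shows "occ u (x @ [c]) = m"
proof -
  have fork: "is_fork u (Fin x)" and zi: "z i = occ u x"
    using assms fork_i by (metis gen_word.inject(1))+
  have ex: "\<exists>l<i. z l = occ u (x @ [c])" for c
  proof -
    obtain l where "l \<le> n" "z l = occ u (x @ [c])"
      using fork occ_in_range by (metis fork_iff right_special_def)
    then show ?thesis
      using right_special_occ_less fork zi z_less_imp_less by (metis fork_iff)
  qed
  obtain k l where kl: "k < i" "l < i" "z k = occ u (x @ [c])" "z l = occ u (x @ [other c])"
    using ex by metis
  have sum: "z i = z k + z l"
    using kl zi occ_snoc[of x c] by simp
  have bd: "z r \<le> z (i - 2)" if "r < i - 1" for r
    using that i_bounds by (intro z_mono) auto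
  have bd1: "z r \<le> z (i - 1)" if "r < i" for r
    using that i_bounds by (intro z_mono) auto
  have "\<not> k < i - 1"
    using bd[of k] bd1[of l] sum z_i kl by auto
  then have "k = i - 1"
    using kl by simp
  then show ?thesis
    using kl by (simp add: m_def)
qed

lemma z_i_eq: "z i = 2 * m"
  using fork_i occ_snoc_eq_m occ_snoc by (metis mult_2)

lemma z_pred_less: "z (i - 2) < m"
  using z_i z_i_eq by (simp add: m_def)

lemma gap:
  assumes "0 < occ u x"
  obtains "occ u x \<le> z (i - 2)" | "occ u x = m" | "2 * m \<le> occ u x"
proof -
  obtain l where l: "l \<le> n" "z l = occ u x"
    using assms occ_in_range by blast
  consider "l \<le> i - 2" | "l = i - 1" | "i \<le> l"
    by linarith
  then show ?thesis
    using l that i_bounds z_mono[of l "i - 2"] z_mono[of i l] z_i_eq by cases (auto simp: m_def)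
qed

lemma gap_ge: "m < occ u x \<Longrightarrow> 2 * m \<le> occ u x"
  by (rule gap[of x]) (use z_pred_less in auto)

definition w :: "letter list" where
  "w = (THE w. v (i - 1) = Fin w)"

lemma v_pred: "v (i - 1) = Fin w"
proof -
  have "\<exists>w. v (i - 1) = Fin w"
    using i_bounds
    by (metis finite_forkE diff_le_self le_trans zero_less_diff less_le_trans
        one_less_numeral_iff semiring_norm(76))
  then show ?thesis
    by (auto simp: w_def)
qed

lemma fork_w: "is_fork u (Fin w)" and occ_w: "occ u w = m"
  using fork_v[of "i - 1"] i_bounds v_pred by (simp_all add: m_def z_def occ_def)

lemma m_ge_2: "2 \<le> m"
  using fork_w occ_w occ_ge_2 fork_iff by metis

text \<open>Since \<open>z (i - 2) < m < z i\<close>, monotonicity leaves only the index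
  \<open>i - 1\<close> for significance \<open>m\<close>.\<close>

lemma unique_fork:
  assumes "is_fork u (Fin x)" and "occ u x = m"
  shows "x = w"
proof -
  obtain l where l: "l \<le> n" "v l = Fin x"
    using assms fork_index by blast
  then have "z l = m"
    using assms by (simp add: z_def occ_def)
  moreover have "z l \<le> z (i - 2)" if "l \<le> i - 2"
    using that i_bounds by (intro z_mono) auto
  moreover have "z i \<le> z l" if "i \<le> l"
    using that l by (intro z_mono) auto
  ultimately have "\<not> l \<le> i - 2" "\<not> i \<le> l"
    using z_pred_less z_i_eq m_ge_2 by auto
  then have "l = i - 1"
    by linarith
  then show ?thesis
    using l v_pred by simp
qed

lemma w_nonempty: "w \<noteq> []"
proof
  assume "w = []"
  then have "v (i - 1) = v n"
    using v_pred v_n by simp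
  then show False
    using v_eq_iff[of "i - 1" n] i_bounds by linarith
qed

section \<open>The longest proper fork prefix of the preceding fork\<close>

definition p :: "letter list" where
  "p = longest_fork_prefix u w"

lemma p_prefix: "strict_prefix p w" and fork_p: "is_fork u (Fin p)"
  and p_longest: "strict_prefix q w \<Longrightarrow> is_fork u (Fin q) \<Longrightarrow> length q \<le> length p"
proof -
  let ?P = "\<lambda>q. strict_prefix q w \<and> is_fork u (Fin q)"
  have nil: "?P []"
    using w_nonempty fork_v[of n] v_n by (cases w) auto
  have bound: "\<And>q. ?P q \<Longrightarrow> length q \<le> length w"
    by (auto dest: prefix_length_less)
  have "?P p"
    unfolding p_def longest_fork_prefix_def
    by (rule arg_max_natI[where b = "Suc (length w)"])
      (use nil bound in \<open>auto simp: less_Suc_eq_le\<close>)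
  then show "strict_prefix p w" "is_fork u (Fin p)"
    by auto
  show "length q \<le> length p" if "strict_prefix q w" "is_fork u (Fin q)"
    unfolding p_def longest_fork_prefix_def
    by (rule arg_max_nat_le[where b = "Suc (length w)" and P = ?P])
      (use that bound in \<open>auto simp: less_Suc_eq_le\<close>)
qed

definition c :: letter where
  "c = w ! length p"

lemma w_split:
  obtains t where "w = p @ c # t"
  using p_prefix by (auto simp: strict_prefix_def prefix_def c_def neq_Nil_conv)

text \<open>Prefixes strictly between \<open>p\<close> and \<open>w\<close> are left special because
  \<open>w\<close> is, but they are not forks by maximality of \<open>p\<close>. So none is right
  special, each next letter is forced, and the count stays that of \<open>w\<close>.\<close>

lemma occ_p_c: "occ u (p @ [c]) = m"
proof -
  obtain t where t: "w = p @ [c] @ t"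
    using w_split by auto
  have "occ u (p @ [c] @ take l t) = occ u (p @ [c])" for l
  proof (induction l)
    case (Suc l)
    show ?case
    proof (cases "l < length t")
      case True
      let ?q = "p @ [c] @ take l t"
      have w: "w = ?q @ t ! l # drop (Suc l) t"
        using t True by (simp add: id_take_nth_drop[symmetric])
      have "\<not> is_fork u (Fin ?q)"
        using p_longest[of ?q] w by (auto simp: strict_prefix_def prefix_def)
      moreover have "left_special u ?q"
        using fork_w w left_special_prefix fork_iff by metis
      ultimately have "\<not> right_special u ?q"
        by (simp add: fork_iff)
      then obtain e where e: "occ u (?q @ [e]) = occ u ?q"
        by (auto elim: not_right_specialE)
      have "0 < occ u (?q @ [t ! l])"
        using occ_w m_ge_2 w occ_append_le[of "?q @ [t ! l]" "drop (Suc l) t"] by simp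
      then have "t ! l = e"
        using e occ_snoc[of ?q e] letter_cases[of "t ! l" e] by auto
      then show ?thesis
        using e Suc True by (simp add: take_Suc_conv_app_nth)
    qed (use Suc in simp)
  qed simp
  from this[of "length t"] show ?thesis
    using t occ_w by simp
qed

text \<open>Every occurrence of \<open>p @ [c]\<close> continues to \<open>w\<close>, so prepending
  \<open>e\<close> has the same effect on both counts, and \<open>w\<close> is left special.\<close>

lemma occ_p_c_prepend: "occ u (e # p @ [c]) < m"
proof -
  obtain t where t: "w = (p @ [c]) @ t"
    using w_split by auto
  have "occ u (e # p @ [c]) = occ u (e # w)"
    using occ_Cons_append_eq[of "p @ [c]" t e] occ_p_c occ_w t by simp
  then show ?thesis
    using left_special_occ_less[of w e] fork_w occ_w by (simp add: fork_iff)
qed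

lemma occ_p_c_prepend_pos: "0 < occ u (e # p @ [c])"
proof -
  obtain t where "w = (p @ [c]) @ t"
    using w_split by auto
  then have "left_special u (p @ [c])"
    using fork_w left_special_prefix by (metis fork_iff)
  then show ?thesis
    by (simp add: left_special_def)
qed

lemma occ_p_other: "2 * m \<le> occ u (p @ [other c])"
proof -
  let ?x = "p @ [other c]"
  have pos: "0 < occ u ?x"
    using fork_p by (simp add: fork_iff right_special_def)
  have sum: "occ u p = m + occ u ?x"
    using occ_snoc[of p c] occ_p_c by simp
  from pos show ?thesis
  proof (cases rule: gap)
    \<comment> \<open>The sum \<open>occ u p = m + occ u ?x\<close> would lie strictly between
      \<open>m\<close> and \<open>2 * m\<close>.\<close>
    case 1
    then show ?thesis
      using sum z_pred_less pos gap_ge[of p] by simp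
  next
    \<comment> \<open>The fork extending \<open>?x\<close> must be \<open>w\<close>. As
      \<open>w\<close> begins with \<open>p @ [c]\<close>, the left part \<open>s\<close> is
      nonempty, so its last letter \<open>e\<close> precedes every \<open>?x\<close>. Then
      \<open>occ u (e # p)\<close> is \<open>m\<close> plus a number strictly between 0 and
      \<open>m\<close>, which falls into the gap.\<close>
    case 2
    obtain s t where w: "w = s @ ?x @ t"
      using pos
    proof (cases rule: fork_closure)
      case (word s t)
      then show ?thesis
        using that unique_fork 2 by metis
    qed (use 2 m_ge_2 in simp)
    obtain t' where t': "w = p @ c # t'"
      by (rule w_split)
    have "s \<noteq> []"
      using w t' other_neq[of c] by auto
    then obtain s' e where s: "s = s' @ [e]"
      by (cases s rule: rev_cases) auto
    have "m \<le> occ u (e # ?x)"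
      using occ_w occ_append_le[of "s' @ e # ?x" t] occ_prepend_le[of s' "e # ?x"] w s by simp
    moreover have "occ u (e # ?x) \<le> m"
      using 2 occ_prepend_le[of "[e]" ?x] by simp
    ultimately have "m < occ u (e # p)" "occ u (e # p) < 2 * m"
      using occ_snoc[of "e # p" c] occ_p_c_prepend[of e] occ_p_c_prepend_pos[of e] by auto
    then show ?thesis
      using gap_ge[of "e # p"] by simp
  qed
qed

text \<open>If \<open>e # p\<close> has at least half of the occurrences of \<open>p\<close>, then it is right special, because
  \<open>e # p @ [c]\<close> is rare; its left closure is the required fork.\<close>

lemma rarer_fork:
  assumes "m \<le> M" and "2 * M < occ u p"
  obtains q where "is_fork u (Fin q)" and "M < occ u q" and "occ u q < occ u p"
    and "occ u (q @ [c]) < m"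
proof -
  \<comment> \<open>The counts of the two left extensions of \<open>p\<close> add up to more than
    \<open>2 * M\<close>, so one of them exceeds \<open>M\<close>.\<close>
  obtain e where e: "M < occ u (e # p)"
    using occ_Cons[of p La] assms that[of La] that[of "other La"] by linarith
  have "0 < occ u ((e # p) @ [other c])"
    using occ_snoc[of "e # p" c] occ_p_c_prepend[of e] e assms by simp
  then have "right_special u (e # p)"
    using occ_p_c_prepend_pos[of e] letter_cases[of _ c] unfolding right_special_def by (metis append_Cons)
  then obtain s where s: "is_fork u (Fin (s @ e # p))" "occ u (s @ e # p) = occ u (e # p)"
    by (rule left_closure)
  show ?thesis
  proof (rule that[OF s(1)])
    show "M < occ u (s @ e # p)" "occ u (s @ e # p) < occ u p"
      using s e left_special_occ_less[of p e] fork_p by (simp_all add: fork_iff)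
    show "occ u ((s @ e # p) @ [c]) < m"
      using occ_prepend_snoc_eq[OF s(2), of c] occ_p_c_prepend[of e] by simp
  qed
qed

section \<open>Candidates for the intermediate fork and the inequalities for both indices\<close>

lemma occ_p_gt: "2 * m < occ u p"
  using occ_snoc[of p c] occ_p_c occ_p_other m_ge_2 by simp

text \<open>These are the candidates for the fork at \<open>k(i)\<close>: the bounds on
  \<open>occ u q\<close> place it between \<open>i\<close> and \<open>j(i)\<close>, and the rare
  extension both excludes the exceptional fork itself and yields the summand
  \<open>z (i - 2)\<close>.\<close>

definition short_fork :: "letter list \<Rightarrow> bool" where
  "short_fork q \<longleftrightarrow> is_fork u (Fin q) \<and> 2 * m \<le> occ u q \<and> occ u q < occ u p \<and>
     (\<exists>e. occ u (q @ [e]) < m)"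

lemma short_fork_minimal:
  obtains q where "short_fork q" and "\<And>r. short_fork r \<Longrightarrow> occ u q \<le> occ u r"
proof -
  obtain q where "is_fork u (Fin q)" "m < occ u q" "occ u q < occ u p" "occ u (q @ [c]) < m"
    using rarer_fork[of m] occ_p_gt by blast
  then have "short_fork q"
    using gap_ge unfolding short_fork_def by blast
  then show ?thesis
    using that ex_has_least_nat[of short_fork q "occ u"] by blast
qed

lemma Psi_eq: "Psi u v i = Fin p"
  using v_pred by (simp add: Psi_def p_def)

lemma p_index:
  assumes "j \<le> n" and "v j = Fin p"
  shows "z j \<le> z (j - 1) + z (i - 1)" and "regular u n v j"
proof -
  have zj: "z j = occ u p"
    using assms by (simp add: z_def occ_def)
  have "occ u (p @ [other c]) \<le> z (j - 1)"
    using fork_p zj assms right_special_occ_less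
    by (intro occ_less_le_pred) (simp_all add: fork_iff right_special_def)
  then show "z j \<le> z (j - 1) + z (i - 1)"
    using zj occ_snoc[of p c] occ_p_c by (simp add: m_def)
  \<comment> \<open>Exceptional forks have equally frequent right extensions, whereas those of
    \<open>p\<close> occur \<open>m\<close> and at least \<open>2 * m\<close> times.\<close>
  have False if "exceptional u n v j"
  proof -
    interpret J: exceptional_fork u n v j
      by unfold_locales (rule that)
    show False
      using J.occ_snoc_eq_m[OF assms(2), of c] J.occ_snoc_eq_m[OF assms(2), of "other c"]
        occ_p_c occ_p_other m_ge_2
      by simp
  qed
  then show "regular u n v j"
    using assms by (auto simp: regular_def)
qed

lemma short_fork_index:
  assumes "short_fork q" and "k \<le> n" and "v k = Fin q" and "j \<le> n" and "v j = Fin p"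
  shows "i < k" and "k < j" and "z k \<le> z (k - 1) + z (i - 2)" and "regular u n v k"
proof -
  have zk: "z k = occ u q" and zj: "z j = occ u p"
    using assms by (simp_all add: z_def occ_def)
  obtain e where q: "is_fork u (Fin q)" "2 * m \<le> occ u q" "occ u q < occ u p" "occ u (q @ [e]) < m"
    using assms(1) unfolding short_fork_def by blast
  show "k < j"
    using q zk zj assms z_less_imp_less[of k j] by simp
  have "i - 1 < k"
    using q(2) zk m_ge_2 i_bounds z_less_imp_less[of "i - 1" k] by (simp add: m_def)
  \<comment> \<open>Both right extensions of the fork at \<open>i\<close> occur exactly
    \<open>m\<close> times, but \<open>q @ [e]\<close> is rarer.\<close>
  moreover have "k \<noteq> i"
    using occ_snoc_eq_m[of q e] q(4) assms(3) by auto
  ultimately show "i < k"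
    by simp
  \<comment> \<open>Any positive count below \<open>m\<close> is at most \<open>z (i - 2)\<close> by
    the gap.\<close>
  have "0 < occ u (q @ [f])" "occ u (q @ [f]) < occ u q" for f
    using q(1) right_special_occ_less by (simp_all add: fork_iff right_special_def)
  then have "occ u (q @ [other e]) \<le> z (k - 1)" and "occ u (q @ [e]) \<le> z (i - 2)"
    using occ_less_le_pred[of "q @ [other e]" k] zk assms gap[of "q @ [e]"] q(4) by auto
  then show "z k \<le> z (k - 1) + z (i - 2)"
    using zk occ_snoc[of q e] by simp
  \<comment> \<open>The extension by \<open>e\<close> has fewer than \<open>m\<close> of at least
    \<open>2 * m\<close> occurrences, so the two extensions are not equally frequent.\<close>
  have False if "exceptional u n v k"
  proof -
    interpret K: exceptional_fork u n v k
      by unfold_locales (rule that)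
    show False
      using K.occ_snoc_eq_m[OF assms(3)] occ_snoc[of q e] q by simp
  qed
  then show "regular u n v k"
    using assms by (auto simp: regular_def)
qed

end

section \<open>Comparison of two exceptional indices\<close>

context fork_list
begin

lemma exceptional_fork: "exceptional u n v i \<Longrightarrow> exceptional_fork u n v i"
  by unfold_locales

text \<open>The index is determined by \<open>m\<close>, which is the smaller one of the numbers of occurrences of
  \<open>p @ [La]\<close> and \<open>p @ [Lb]\<close>.\<close>

lemma p_inj:
  assumes "exceptional u n v i" and "exceptional u n v i'"
    and "exceptional_fork.p u v i = exceptional_fork.p u v i'"
  shows "i = i'"
proof -
  interpret I: exceptional_fork u n v i by (rule exceptional_fork) fact
  interpret I': exceptional_fork u n v i' by (rule exceptional_fork) fact
  \<comment> \<open>If the letters \<open>I.c\<close> and \<open>I'.c\<close> differed, each of the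
    two values would be at least twice the other.\<close>
  have "I.m = I'.m"
    using I.occ_p_c I.occ_p_other I'.occ_p_c I'.occ_p_other assms(3) letter_cases[of I'.c I.c]
      I.m_ge_2 I'.m_ge_2 by auto
  then have "I.w = I'.w"
    using I'.unique_fork I.fork_w I.occ_w by simp
  then have "i - 1 = i' - 1"
    using I.v_pred I'.v_pred v_eq_iff[of "i - 1" "i' - 1"] I.i_bounds I'.i_bounds by simp
  then show ?thesis
    using I.i_bounds I'.i_bounds by linarith
qed

text \<open>Otherwise \<open>rarer_fork\<close> for \<open>i'\<close>, with bound
  \<open>M = I.m\<close>, produces a fork with fewer occurrences than \<open>q\<close> that is still
  short for \<open>i\<close>.\<close>

lemma minimal_short_fork_neq_p:
  assumes "exceptional u n v i" and "exceptional u n v i'"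
    and q: "exceptional_fork.short_fork u v i q"
    and min: "\<And>r. exceptional_fork.short_fork u v i r \<Longrightarrow> occ u q \<le> occ u r"
  shows "q \<noteq> exceptional_fork.p u v i'"
proof
  interpret I: exceptional_fork u n v i by (rule exceptional_fork) fact
  interpret I': exceptional_fork u n v i' by (rule exceptional_fork) fact
  assume eq: "q = I'.p"
  obtain e where e: "2 * I.m \<le> occ u q" "occ u q < occ u I.p" "occ u (q @ [e]) < I.m"
    using q unfolding I.short_fork_def by blast
  \<comment> \<open>Whichever letter \<open>e\<close> is, \<open>q @ [e]\<close> occurs at least
    \<open>I'.m\<close> times.\<close>
  have less: "I'.m < I.m"
    using e(3) letter_cases[of e I'.c] I'.occ_p_c I'.occ_p_other eq by auto
  then have "I.m < occ u (q @ [other I'.c])"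
    using e(1) occ_snoc[of q I'.c] I'.occ_p_c eq by simp
  \<comment> \<open>The gap at \<open>i\<close> raises the larger summand of \<open>occ u q\<close>
    to at least \<open>2 * I.m\<close>, and the other summand \<open>I'.m\<close> is
    positive.\<close>
  then have "2 * I.m < occ u I'.p"
    using I.gap_ge occ_snoc[of q I'.c] I'.occ_p_c I'.m_ge_2 eq by fastforce
  then obtain r where "is_fork u (Fin r)" "I.m < occ u r" "occ u r < occ u I'.p"
      "occ u (r @ [I'.c]) < I'.m"
    using I'.rarer_fork[of I.m] less by auto
  moreover from this have "I.short_fork r"
    using I.gap_ge e(2) less eq unfolding I.short_fork_def by (metis less_trans)
  ultimately show False
    using min eq by (meson leD)
qed

end

theorem theorem3p16:
  fixes u :: "letter list" and n :: nat and v :: "nat \<Rightarrow> gen_word" and z :: "nat \<Rightarrow> nat"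
  assumes "u \<noteq> []"
    and "\<not> periodic_word u"
    and "fork_enumeration u n v"
    and "\<And>i. z i = significance u (v i)"
  shows "\<exists>j k.
    (\<forall>i. exceptional u n v i \<longrightarrow>
       j i \<le> n \<and> v (j i) = Psi u v i \<and>
       i < k i \<and> k i < j i \<and>
       z (j i) \<le> z (j i - 1) + z (i - 1) \<and>
       z (k i) \<le> z (k i - 1) + z (i - 2)) \<and>
    (\<forall>i i'. exceptional u n v i \<and> exceptional u n v i' \<and> i \<noteq> i' \<longrightarrow> j i \<noteq> j i') \<and>
    (\<forall>i i'. exceptional u n v i \<and> exceptional u n v i' \<longrightarrow> k i \<noteq> j i') \<and>
    (\<forall>i. exceptional u n v i \<longrightarrow> regular u n v (j i) \<and> regular u n v (k i))"
proof -
  interpret F: fork_list u n v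
    by unfold_locales (use assms in auto)
  have z: "z = F.z"
    using assms(4) by (simp add: fun_eq_iff F.z_def)
  \<comment> \<open>The fork \<open>q\<close> is chosen along with its index so that its minimality
    is at hand when \<open>k i\<close> is compared with every \<open>j i'\<close>.\<close>
  have "\<exists>j k q. j \<le> n \<and> v j = Fin (exceptional_fork.p u v i) \<and>
      k \<le> n \<and> v k = Fin q \<and> exceptional_fork.short_fork u v i q \<and>
      (\<forall>r. exceptional_fork.short_fork u v i r \<longrightarrow> occ u q \<le> occ u r)"
    if "exceptional u n v i" for i
  proof -
    interpret I: exceptional_fork u n v i by (rule F.exceptional_fork) fact
    obtain q where q: "I.short_fork q" "\<And>r. I.short_fork r \<Longrightarrow> occ u q \<le> occ u r"
      using I.short_fork_minimal by blast
    then have "is_fork u (Fin q)"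
      by (simp only: I.short_fork_def)
    then show ?thesis
      using q I.fork_p F.fork_index by metis
  qed
  then obtain j k q where jkq: "\<And>i. exceptional u n v i \<Longrightarrow>
      j i \<le> n \<and> v (j i) = Fin (exceptional_fork.p u v i) \<and>
      k i \<le> n \<and> v (k i) = Fin (q i) \<and> exceptional_fork.short_fork u v i (q i) \<and>
      (\<forall>r. exceptional_fork.short_fork u v i r \<longrightarrow> occ u (q i) \<le> occ u r)"
    by metis
  have props: "j i \<le> n \<and> v (j i) = Psi u v i \<and> i < k i \<and> k i < j i \<and>
      z (j i) \<le> z (j i - 1) + z (i - 1) \<and> z (k i) \<le> z (k i - 1) + z (i - 2)"
    and reg: "regular u n v (j i) \<and> regular u n v (k i)" if i: "exceptional u n v i" for i
  proof -
    interpret I: exceptional_fork u n v i by (rule F.exceptional_fork) fact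
    have j: "j i \<le> n" "v (j i) = Fin I.p"
      and k: "k i \<le> n" "v (k i) = Fin (q i)" "I.short_fork (q i)"
      using jkq[OF i] by blast+
    show "j i \<le> n \<and> v (j i) = Psi u v i \<and> i < k i \<and> k i < j i \<and>
        z (j i) \<le> z (j i - 1) + z (i - 1) \<and> z (k i) \<le> z (k i - 1) + z (i - 2)"
      using j I.Psi_eq I.p_index(1)[OF j] I.short_fork_index(1-3)[OF k(3,1,2) j] unfolding z by simp
    show "regular u n v (j i) \<and> regular u n v (k i)"
      using I.p_index(2)[OF j] I.short_fork_index(4)[OF k(3,1,2) j] by simp
  qed
  have "j i \<noteq> j i'" if "exceptional u n v i" "exceptional u n v i'" "i \<noteq> i'" for i i'
    using that jkq[of i] jkq[of i'] F.p_inj[of i i'] by auto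
  moreover have "k i \<noteq> j i'" if "exceptional u n v i" "exceptional u n v i'" for i i'
    using that jkq[of i] jkq[of i'] F.minimal_short_fork_neq_p[of i i' "q i"] by auto
  ultimately show ?thesis
    using props reg by (intro exI[of _ j] exI[of _ k]) blast
qed

end
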